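(* For every real $\lambda\in(1,2)$ one has \[ R(\lambda)=\sum_{i=1}^{\infty}\frac{1}{a_i}, \] where the sequence $(a_i)_{i=1}^{\infty}$ (depending on $\lambda$) is recursively defined by $a_1:=1$ and $a_{i+1}:=\lceil\lambda a_i\rceil$ for $i\geqslant 1$. Moreover, \[ \lim_{\lambda\to1^+}R(\lambda)=+\infty,\qquad \lim_{\lambda\to2^-}R(\lambda)=2, \] and $R(\lambda)=0$ for every $\lambda\geqslant 2$.
   Context: $\mathbb{N}=\{1,2,3,\ldots\}$. For a real $\lambda>1$, a sequence $(n_i)_{i=1}^{\infty}$ of positive integers is called $\lambda$-lacunary if $n_{i+1}/n_i\geqslant\lambda$ for every $i\in\mathbb{N}$. For a sequence of positive reals $(x_i)_{i=1}^{\infty}$ one denotes \[ P((x_i)_{i=1}^{\infty}) := \Big\{ \sum_{i\in T} x_i \,:\, T\subset\mathbb{N} \text{ finite} \Big\}. \] For every $\lambda\in(1,\infty)$, $R(\lambda)$ is defined as the least upper bound of the lengths $\beta-\alpha$ of intervals $(\alpha,\beta)$ for which there exists a $\lambda$-lacunary sequence of positive integers $(n_i)_{i=1}^{\infty}$ such that $P((1/n_i)_{i=1}^{\infty})$ contains all rational numbers from $(\alpha,\beta)$. Degenerate (empty) intervals with $\alpha=\beta$ are allowed, so that $R(\lambda)=0$ when no non-empty open interval has this property. *)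

theory Defs
  imports Complex_Main
begin

text \<open>
  All sequences are indexed from 0 here, so the \<open>i\<close>-th member of a sequence
  indexed by the positive integers is the value at \<open>i - 1\<close>.
\<close>

definition lacunary :: "real \<Rightarrow> (nat \<Rightarrow> nat) \<Rightarrow> bool" where
  "lacunary lam n \<longleftrightarrow> (\<forall>i. n i > 0) \<and> (\<forall>i. real (n (Suc i)) / real (n i) \<ge> lam)"

definition P :: "(nat \<Rightarrow> real) \<Rightarrow> real set" where
  "P x = {\<Sum>i\<in>T. x i | T. finite T}"

definition lengths :: "real \<Rightarrow> real set" where
  "lengths lam = {\<beta> - \<alpha> | \<alpha> \<beta>. \<alpha> \<le> \<beta> \<and>
     (\<exists>n. lacunary lam n \<and> \<rat> \<inter> {\<alpha><..<\<beta>} \<subseteq> P (\<lambda>i. 1 / real (n i)))}"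

text \<open>
  The supremum of a set of reals is meaningful only for nonempty sets that are
  bounded above; for \<open>lam > 1\<close> this is \<open>lengths_nonempty\<close> and \<open>bdd_above_lengths\<close> below.
\<close>

definition R :: "real \<Rightarrow> real" where
  "R lam = Sup (lengths lam)"

primrec a :: "real \<Rightarrow> nat \<Rightarrow> nat" where
  "a lam 0 = 1"
| "a lam (Suc i) = nat \<lceil>lam * real (a lam i)\<rceil>"

lemma lacunary_a:
  assumes "lam > 1"
  shows "lacunary lam (a lam)"
proof -
  have pos: "a lam i > 0" for i
    using assms by (induction i) simp_all
  have "real (a lam (Suc i)) \<ge> lam * real (a lam i)" for i
    by (simp only: a.simps real_nat_ceiling_ge)
  with pos show ?thesis
    by (simp add: lacunary_def pos_le_divide_eq del: a.simps)
qed

lemma lengths_nonempty: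
  assumes "lam > 1"
  shows "lengths lam \<noteq> {}"
proof -
  have "\<rat> \<inter> {0<..<0} \<subseteq> P (\<lambda>i. 1 / real (a lam i))"
    by simp
  with lacunary_a[OF assms] have "0 - 0 \<in> lengths lam"
    unfolding lengths_def by blast
  then show ?thesis by blast
qed

lemma lacunary_growth:
  assumes "lam > 1" "lacunary lam n"
  shows "real (n i) \<ge> lam ^ i"
proof (induction i)
  case 0
  show ?case using assms(2) by (simp add: lacunary_def Suc_leI)
next
  case (Suc i)
  have "real (n (Suc i)) \<ge> lam * real (n i)"
  proof -
    have "real (n (Suc i)) / real (n i) \<ge> lam" "real (n i) > 0"
      using assms(2) by (auto simp: lacunary_def)
    then show ?thesis by (simp add: pos_le_divide_eq)
  qed
  moreover have "lam * real (n i) \<ge> lam * lam ^ i"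
    using Suc assms(1) by (intro mult_left_mono) auto
  ultimately show ?case by simp
qed

lemma P_bounds:
  assumes "lam > 1" "lacunary lam n" "q \<in> P (\<lambda>i. 1 / real (n i))"
  shows "0 \<le> q" "q \<le> 1 / (1 - 1 / lam)"
proof -
  obtain T where T: "finite T" "q = (\<Sum>i\<in>T. 1 / real (n i))"
    using assms(3) by (auto simp: P_def)
  show "0 \<le> q" unfolding T by (intro sum_nonneg) auto
  have "q \<le> (\<Sum>i\<in>T. (1 / lam) ^ i)" unfolding T
  proof (rule sum_mono)
    fix i
    have "lam ^ i > 0" using assms(1) by simp
    with lacunary_growth[OF assms(1,2), of i] show "1 / real (n i) \<le> (1 / lam) ^ i"
      by (simp add: power_one_over frac_le)
  qed
  also have "\<dots> \<le> (\<Sum>i. (1 / lam) ^ i)"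
    using assms(1) T(1) by (intro sum_le_suminf summable_geometric) auto
  also have "\<dots> = 1 / (1 - 1 / lam)"
    using assms(1) by (intro suminf_geometric) auto
  finally show "q \<le> 1 / (1 - 1 / lam)" .
qed

lemma bdd_above_lengths:
  assumes "lam > 1"
  shows "bdd_above (lengths lam)"
proof (rule bdd_aboveI)
  let ?C = "1 / (1 - 1 / lam)"
  fix l assume "l \<in> lengths lam"
  then obtain \<alpha> \<beta> n where l: "l = \<beta> - \<alpha>" "lacunary lam n"
    and sub: "\<rat> \<inter> {\<alpha><..<\<beta>} \<subseteq> P (\<lambda>i. 1 / real (n i))"
    by (auto simp: lengths_def)
  show "l \<le> ?C"
  proof (rule ccontr)
    assume "\<not> l \<le> ?C"
    then have gt: "\<alpha> + ?C < \<beta>" using l by simp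
    have C: "?C > 0" using assms by simp
    have in_bounds: "0 \<le> q \<and> q \<le> ?C" if "q \<in> \<rat>" "\<alpha> < q" "q < \<beta>" for q
    proof -
      have "q \<in> P (\<lambda>i. 1 / real (n i))"
        by (rule subsetD[OF sub]) (simp add: that)
      then show ?thesis
        using P_bounds[OF assms l(2)] by simp
    qed
    have "max \<alpha> (\<alpha> + ?C) < \<beta>" using gt C by linarith
    from Rats_dense_in_real[OF this]
    obtain q where q: "q \<in> \<rat>" "max \<alpha> (\<alpha> + ?C) < q" "q < \<beta>" by auto
    have "q \<le> ?C" using in_bounds q by auto
    then have "\<alpha> < 0" using q(2) by linarith
    then have "\<alpha> < min 0 \<beta>" using gt C by linarith
    from Rats_dense_in_real[OF this]
    obtain r where r: "r \<in> \<rat>" "\<alpha> < r" "r < min 0 \<beta>" by auto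
    then have "0 \<le> r" using in_bounds by auto
    then show False using r(3) by linarith
  qed
qed

end

theory Submission
  imports Defs "HOL-Analysis.Summation_Tests" "HOL-Computational_Algebra.Primes"
begin

text \<open>Every $\lambda$-lacunary sequence dominates \<open>a lam\<close> termwise, so all the finite subset sums lie
  between 0 and $S = \sum_i 1/a_i$, and a represented interval has length at most $S$
  (\<open>lengths_le_suminf_a\<close>). For $\lambda < 2$ this is sharp because one can keep any initial segment
  $a_0, \dots, a_N$ and continue it so that every rational in $(0, \sum_{i \le N} 1/a_i)$ is represented
  (\<open>sum_a_in_lengths\<close>).

  Two observations make the continuation possible. Suppose that the ratios of consecutive terms are
  at most 2 and that $n_0, \dots, n_m$ all divide $n_m$. Then the integers $n_m/n_i$ end in 1 and grow
  at most by a factor 2 when read backwards, so their subset sums fill the whole integer interval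
  up to their total; dividing by $n_m$, every fraction with denominator $n_m$ up to
  $\sum_{i \le m} 1/n_i$ is a subset sum (\<open>fraction_in_P\<close>). It remains to make infinitely many $n_m$
  multiples of all earlier terms and of a prescribed $q$. Multiples of a number $K$ are sparse only at
  small scales: for large $c$ there is a multiple $w$ of $K$ in $[\lambda 2^c, 2^{c+1}]$, since
  $\lambda < 2$. From a term $x$ the sequence doubles $c$ times, then steps from $2^c x$ to $w x$, whose ratio
  lies in $[\lambda, 2]$, and then doubles $c$ times more, up to $2^c w x$, which is divisible by
  every new term and by $K$ (\<open>slow_extension\<close>). Iterating with $K$ covering each possible denominator
  gives the sequence.

  The two limits follow from the series. Near 1 the sequence \<open>a lam\<close> starts as
  $1, 2, 3, \dots, N$, so the harmonic series forces divergence; for all $\lambda \in (1, 2)$ one has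
  $\lambda^i \le a_i \le 2^i$, which squeezes $R(\lambda)$ between two geometric series near 2.

  For $\lambda \ge 2$ no nonempty interval is represented. If the ratio exceeds 2 infinitely often, then
  arbitrarily late terms exceed the sum of everything after them, and this opens a gap
  next to every subset sum (\<open>sum_halving_gap\<close>). Otherwise the sequence eventually doubles exactly, only
  finitely many primes occur in the denominators, and fractions with a large prime denominator
  are missed (\<open>P_misses_rational_of_eventual_doubling\<close>).\<close>

section \<open>Subset sums under a doubling condition\<close>

text \<open>The sequence is read downwards from its last value 1. The first conjunct says that a new term
  exceeds the total of the smaller ones by at most 1; hence the interval reached by the smaller terms
  and its translate by the new term leave no integer out.\<close>

lemma subset_sums_fill_interval:
  fixes e :: "nat \<Rightarrow> nat"
  assumes last: "e m = 1" and ratio: "\<And>i. i < m \<Longrightarrow> e i \<le> 2 * e (Suc i)"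
    and "k \<le> m"
  shows "2 * e k \<le> Suc (sum e {k..m}) \<and>
    (\<forall>x \<le> sum e {k..m}. \<exists>T \<subseteq> {k..m}. x = sum e T)"
  using \<open>k \<le> m\<close>
proof (induction k rule: inc_induct)
  case base
  have "\<exists>T \<subseteq> {m..m}. x = sum e T" if "x \<le> sum e {m..m}" for x
  proof (cases "x = 0")
    case True
    then show ?thesis by (intro exI[of _ "{}"]) simp
  next
    case False
    then show ?thesis using that last by (intro exI[of _ "{m}"]) simp
  qed
  then show ?case using last by simp
next
  case (step k)
  have split: "sum e {k..m} = e k + sum e {Suc k..m}"
    using step.hyps by (simp add: sum.atLeast_Suc_atMost)
  have bound: "e k \<le> Suc (sum e {Suc k..m})"
    using ratio[OF step.hyps(2)] step.IH by linarith
  have "\<exists>T \<subseteq> {k..m}. x = sum e T" if x: "x \<le> sum e {k..m}" for x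
  proof (cases "x \<le> sum e {Suc k..m}")
    case True
    then obtain T where T: "T \<subseteq> {Suc k..m}" "x = sum e T"
      using step.IH by blast
    have "T \<subseteq> {k..m}" using T(1) by fastforce
    then show ?thesis using T(2) by blast
  next
    case False
    then have "e k \<le> x" "x - e k \<le> sum e {Suc k..m}"
      using bound x split by linarith+
    then obtain T where T: "T \<subseteq> {Suc k..m}" "x - e k = sum e T"
      using step.IH by blast
    have fin: "finite T" using T(1) finite_subset by blast
    have notin: "k \<notin> T" using T(1) by auto
    have "x = sum e (insert k T)"
      using fin notin T(2) \<open>e k \<le> x\<close> by simp
    moreover have "insert k T \<subseteq> {k..m}"
      using T(1) step.hyps by fastforce
    ultimately show ?thesis by blast
  qed
  then show ?case using bound split by simp
qed

text \<open>Over the common denominator \<open>n m\<close> the reciprocals become the integers \<open>n m div n i\<close>, to which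
  \<open>subset_sums_fill_interval\<close> applies.\<close>

lemma fraction_in_P:
  fixes n :: "nat \<Rightarrow> nat" and x :: nat
  assumes pos: "\<And>i. n i > 0" and ratio: "\<And>i. n (Suc i) \<le> 2 * n i"
    and dvd: "\<And>i. i \<le> m \<Longrightarrow> n i dvd n m"
    and le: "real x / real (n m) \<le> (\<Sum>i\<le>m. 1 / real (n i))"
  shows "real x / real (n m) \<in> P (\<lambda>i. 1 / real (n i))"
proof -
  define e where "e i = n m div n i" for i
  have e: "real (e i) = real (n m) * (1 / real (n i))" if "i \<le> m" for i
    using dvd[OF that] by (simp add: e_def real_of_nat_div)
  have "e i \<le> 2 * e (Suc i)" if "i < m" for i
  proof -
    have "1 / real (n i) \<le> 2 / real (n (Suc i))"
    proof -
      have "real (n (Suc i)) \<le> 2 * real (n i)" using ratio[of i] by linarith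
      then show ?thesis using pos[of i] pos[of "Suc i"] by (simp add: field_simps)
    qed
    then have "real (n m) * (1 / real (n i)) \<le> real (n m) * (2 / real (n (Suc i)))"
      by (intro mult_left_mono) auto
    then have "real (e i) \<le> real (2 * e (Suc i))"
      using e[of i] e[of "Suc i"] that by (simp add: mult.commute)
    then show ?thesis by linarith
  qed
  moreover have "e m = 1" using pos[of m] by (simp add: e_def)
  ultimately have fill: "\<forall>x \<le> sum e {0..m}. \<exists>T \<subseteq> {0..m}. x = sum e T"
    using subset_sums_fill_interval[of e m 0] by auto
  have sum_e: "real (sum e T) = real (n m) * (\<Sum>i\<in>T. 1 / real (n i))"
    if "T \<subseteq> {0..m}" for T
  proof -
    have "real (sum e T) = (\<Sum>i\<in>T. real (e i))" by simp
    also have "\<dots> = (\<Sum>i\<in>T. real (n m) * (1 / real (n i)))"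
      using that by (intro sum.cong refl e) auto
    finally show ?thesis by (simp add: sum_distrib_left)
  qed
  have "real x \<le> real (n m) * (\<Sum>i\<le>m. 1 / real (n i))"
    using le pos[of m] by (simp add: divide_le_eq mult.commute)
  also have "\<dots> = real (sum e {0..m})"
    using sum_e[of "{0..m}"] by (simp add: atLeast0AtMost)
  finally have "x \<le> sum e {0..m}" by linarith
  then obtain T where T: "T \<subseteq> {0..m}" "x = sum e T" using fill by blast
  have "real x / real (n m) = (\<Sum>i\<in>T. 1 / real (n i))"
    using sum_e[OF T(1)] T(2) pos[of m] by simp
  moreover have "finite T" using T(1) finite_subset by blast
  ultimately show ?thesis unfolding P_def by blast
qed

section \<open>Lacunary sequences with prescribed divisibility\<close>

text \<open>The upper bound 2 on the ratios is imposed on all indices, also beyond a segment that is to be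
  kept, so that a partial construction is again an infinite sequence of the same kind.\<close>

definition slow :: "real \<Rightarrow> (nat \<Rightarrow> nat) \<Rightarrow> bool" where
  "slow lam n \<longleftrightarrow> (\<forall>i. n i > 0 \<and> lam * real (n i) \<le> real (n (Suc i)) \<and> n (Suc i) \<le> 2 * n i)"

lemma lacunary_step: "lacunary lam n \<Longrightarrow> lam * real (n i) \<le> real (n (Suc i))"
  by (metis lacunary_def of_nat_0_less_iff pos_le_divide_eq)

lemma slow_imp_lacunary: "slow lam n \<Longrightarrow> lacunary lam n"
  by (simp add: slow_def lacunary_def pos_le_divide_eq)

lemma slow_a:
  assumes "1 < lam" "lam < 2"
  shows "slow lam (a lam)"
proof -
  have lac: "lacunary lam (a lam)" by (rule lacunary_a) fact
  have "a lam (Suc i) \<le> 2 * a lam i" for i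
  proof -
    have "lam * real (a lam i) \<le> real_of_int (int (2 * a lam i))"
      using assms by (simp add: mult_right_mono)
    then have "\<lceil>lam * real (a lam i)\<rceil> \<le> int (2 * a lam i)" by (simp only: ceiling_le_iff)
    then show ?thesis by (simp only: a.simps nat_le_iff)
  qed
  moreover have "a lam i > 0" for i using lac by (simp add: lacunary_def)
  ultimately show ?thesis using lacunary_step[OF lac]
    by (simp add: slow_def del: a.simps)
qed

text \<open>The interval from $\lambda 2^c$ to $2^{c+1}$ has length $(2 - \lambda) 2^c$, which exceeds \<open>K\<close>
  for large \<open>c\<close>; this is where $\lambda < 2$ enters.\<close>

lemma multiple_near_power_of_two:
  fixes lam :: real and K :: nat
  assumes "lam < 2" "K > 0"
  obtains c w :: nat where "K dvd w" "lam * 2 ^ c \<le> real w" "w \<le> 2 * 2 ^ c" "w > 0"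
proof -
  obtain c :: nat where c: "real K / (2 - lam) < 2 ^ c"
    using real_arch_pow[of 2 "real K / (2 - lam)"] by auto
  obtain c' :: nat where c': "real K < 2 ^ c'"
    using real_arch_pow[of 2 "real K"] by auto
  define d where "d = max c c'"
  have d1: "real K / (2 - lam) < 2 ^ d"
    by (rule less_le_trans[OF c]) (simp add: d_def power_increasing)
  have d2: "real K < 2 ^ d"
    by (rule less_le_trans[OF c']) (simp add: d_def power_increasing)
  \<comment> \<open>the largest multiple of \<open>K\<close> that does not exceed $2^{d+1}$\<close>
  define w where "w = 2 * 2 ^ d div K * K"
  have "2 * 2 ^ d = w + 2 * 2 ^ d mod K" by (simp add: w_def)
  moreover have "2 * 2 ^ d mod K < K" using assms by simp
  ultimately have lt: "2 * 2 ^ d < w + K" by linarith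
  have "w \<le> 2 * 2 ^ d" by (simp add: w_def)
  moreover have "K dvd w" by (simp add: w_def)
  moreover have "real (2 * 2 ^ d) < real (w + K)" using lt by linarith
  then have gt: "2 * 2 ^ d < real w + real K" by simp
  have "real K < (2 - lam) * 2 ^ d" using d1 assms by (simp add: field_simps)
  with gt have "lam * 2 ^ d \<le> real w" by (simp add: algebra_simps)
  moreover have "w > 0"
  proof (rule ccontr)
    assume "\<not> w > 0"
    then have "2 * 2 ^ d < real K" using gt by simp
    moreover have "(0::real) < 2 ^ d" by simp
    ultimately show False using d2 by linarith
  qed
  ultimately show ?thesis using that by blast
qed

text \<open>The terms up to \<open>f m\<close> are kept, and the later ones are $2^i f(m)$ for $i \le c$ followed by
  $2^i w f(m)$ for $i \ge 0$. The second run of doublings is needed up to $i = c$ so that its last term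
  is divisible by the powers of 2 in the first run; the factor \<open>w\<close> takes care of the
  kept terms and of \<open>K\<close>.\<close>

lemma slow_extension:
  assumes "lam < 2" "slow lam f" "K > 0"
  shows "\<exists>g m'. slow lam g \<and> m < m' \<and> (\<forall>i\<le>m. g i = f i) \<and> (\<forall>i\<le>m'. g i dvd g m') \<and> K dvd g m'"
proof -
  have pos: "f i > 0" for i using assms(2) by (simp add: slow_def)
  define L where "L = K * (\<Prod>i\<le>m. f i)"
  have "L > 0" using assms(3) pos by (simp add: L_def prod_pos)
  from multiple_near_power_of_two[OF assms(1) this]
  obtain c w where w: "L dvd w" "lam * 2 ^ c \<le> real w" "w \<le> 2 * 2 ^ c" "w > 0" by blast
  define g where "g i = (if i \<le> m then f i
      else if i \<le> m + c then 2 ^ (i - m) * f m else 2 ^ (i - (m + c + 1)) * w * f m)" for i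
  define m' where "m' = m + c + 1 + c"
  have gm': "g m' = 2 ^ c * w * f m" by (simp add: g_def m'_def)
  have "g i > 0 \<and> lam * real (g i) \<le> real (g (Suc i)) \<and> g (Suc i) \<le> 2 * g i" for i
  proof -
    have gpos: "g i > 0" using pos w(4) by (simp add: g_def)
    have double: ?thesis if "g (Suc i) = 2 * g i"
      using that gpos assms(1) by (simp add: mult_right_mono)
    consider "i < m" | "m \<le> i" "i < m + c" | "i = m + c" | "i > m + c" by linarith
    then show ?thesis
    proof cases
      case 1
      then show ?thesis using assms(2) by (simp add: g_def slow_def)
    next
      case 2
      then have "g (Suc i) = 2 * g i" by (simp add: g_def Suc_diff_le)
      then show ?thesis by (rule double)
    next
      \<comment> \<open>the only new step that does not double: its ratio is $w / 2^c$\<close>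
      case 3
      have gi: "g i = 2 ^ c * f m" by (simp add: g_def 3)
      have gSi: "g (Suc i) = w * f m" by (simp add: g_def 3)
      have "lam * 2 ^ c * real (f m) \<le> real w * real (f m)"
        using w(2) by (rule mult_right_mono) simp
      moreover have "w * f m \<le> 2 * 2 ^ c * f m" using w(3) by (rule mult_right_mono) simp
      ultimately show ?thesis using gpos unfolding gi gSi by (simp add: mult.assoc)
    next
      case 4
      then obtain j where "i = Suc (m + c + j)" using less_imp_Suc_add by blast
      then have "g (Suc i) = 2 * g i" by (simp add: g_def)
      then show ?thesis by (rule double)
    qed
  qed
  then have "slow lam g" by (simp add: slow_def)
  moreover have "m < m'" by (simp add: m'_def)
  moreover have "\<forall>i\<le>m. g i = f i" by (simp add: g_def)
  moreover have "g i dvd g m'" if "i \<le> m'" for i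
  proof -
    consider "i \<le> m" | "m < i" "i \<le> m + c" | "m + c < i" by linarith
    then show ?thesis
    proof cases
      case 1
      then have "f i dvd (\<Prod>i\<le>m. f i)" by (intro dvd_prodI) auto
      then have "f i dvd w" using w(1) unfolding L_def by (meson dvd_trans dvd_triv_right)
      then show ?thesis using 1 by (simp add: gm') (simp add: g_def)
    next
      case 2
      then have "(2::nat) ^ (i - m) dvd 2 ^ c" by (intro le_imp_power_dvd) simp
      then show ?thesis using 2 by (simp add: gm') (simp add: g_def mult_dvd_mono)
    next
      case 3
      then have "(2::nat) ^ (i - (m + c + 1)) dvd 2 ^ c"
        using that by (intro le_imp_power_dvd) (simp add: m'_def)
      then show ?thesis using 3 by (simp add: gm') (simp add: g_def mult_dvd_mono)
    qed
  qed
  moreover have "K dvd g m'"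
  proof -
    have "K dvd w" using w(1) unfolding L_def by (rule dvd_mult_left)
    then show ?thesis by (simp add: gm')
  qed
  ultimately show ?thesis by blast
qed

text \<open>Extensions by \<open>slow_extension\<close> are iterated, with \<open>K = Suc k\<close> in round \<open>k\<close>; each round freezes a longer
  initial segment, and the frozen segments determine the limit sequence.\<close>

lemma slow_sequence_absorbing_denominators:
  assumes "lam < 2" "slow lam f"
  obtains n where "slow lam n" "\<And>i. i \<le> N \<Longrightarrow> n i = f i"
    "\<And>q. \<exists>m\<ge>N. (\<forall>i\<le>m. n i dvd n m) \<and> Suc q dvd n m"
proof -
  \<comment> \<open>A state is a sequence together with the last index of its frozen segment.\<close>
  define Q where "Q k p \<longleftrightarrow> slow lam (fst p) \<and> N + k \<le> snd p \<and> (\<forall>i\<le>N. fst p i = f i)"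
    for k :: nat and p :: "(nat \<Rightarrow> nat) \<times> nat"
  define S where "S k p p' \<longleftrightarrow> (\<forall>i\<le>snd p. fst p' i = fst p i) \<and> snd p < snd p' \<and>
      (\<forall>i\<le>snd p'. fst p' i dvd fst p' (snd p')) \<and> Suc k dvd fst p' (snd p')"
    for k :: nat and p p' :: "(nat \<Rightarrow> nat) \<times> nat"
  have "\<exists>F. \<forall>k. Q k (F k) \<and> S k (F k) (F (Suc k))"
  proof (rule dependent_nat_choice)
    have "Q 0 (f, N)" using assms(2) by (simp add: Q_def)
    then show "\<exists>p. Q 0 p" by blast
  next
    fix p k assume Qp: "Q k p"
    then have "slow lam (fst p)" by (simp add: Q_def)
    from slow_extension[OF assms(1) this, of "Suc k" "snd p"]
    obtain g m' where g: "slow lam g" "snd p < m'" "\<forall>i\<le>snd p. g i = fst p i"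
      "\<forall>i\<le>m'. g i dvd g m'" "Suc k dvd g m'" by auto
    have "Q (Suc k) (g, m')" using Qp g by (auto simp: Q_def)
    moreover have "S k p (g, m')" using g by (simp add: S_def)
    ultimately show "\<exists>p'. Q (Suc k) p' \<and> S k p p'" by blast
  qed
  then obtain F where F: "\<And>k. Q k (F k)" "\<And>k. S k (F k) (F (Suc k))" by blast
  have len: "N + k \<le> snd (F k)" for k using F(1)[of k] by (simp add: Q_def)
  have mono: "snd (F k) \<le> snd (F l)" if "k \<le> l" for k l
  proof (rule lift_Suc_mono_le[OF _ that])
    show "snd (F j) \<le> snd (F (Suc j))" for j using F(2)[of j] by (simp add: S_def)
  qed
  have stable: "fst (F l) i = fst (F k) i" if "k \<le> l" "i \<le> snd (F k)" for k l i
    using that(1)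
  proof (induction l rule: dec_induct)
    case base
    then show ?case by simp
  next
    case (step l)
    have "i \<le> snd (F l)" using mono[OF step.hyps(1)] that(2) by linarith
    then show ?case using F(2)[of l] step.IH by (simp add: S_def)
  qed
  define n where "n i = fst (F i) i" for i
  have n_eq: "n i = fst (F k) i" if "i \<le> snd (F k)" for i k
  proof (cases "k \<le> i")
    case True
    then show ?thesis using stable[OF True that] by (simp add: n_def)
  next
    case False
    then show ?thesis using stable[of i k i] len[of i] by (simp add: n_def)
  qed
  show thesis
  proof
    show "slow lam n" unfolding slow_def
    proof
      fix i
      have "Suc i \<le> snd (F (Suc i))" using len[of "Suc i"] by simp
      then have "n i = fst (F (Suc i)) i" "n (Suc i) = fst (F (Suc i)) (Suc i)"
        by (auto intro!: n_eq)
      moreover have "slow lam (fst (F (Suc i)))" using F(1) by (simp add: Q_def)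
      ultimately show "n i > 0 \<and> lam * real (n i) \<le> real (n (Suc i)) \<and> n (Suc i) \<le> 2 * n i"
        by (simp add: slow_def)
    qed
  next
    fix i assume i: "i \<le> N"
    then have "n i = fst (F 0) i" using len[of 0] by (intro n_eq) simp
    then show "n i = f i" using F(1)[of 0] i by (simp add: Q_def)
  next
    fix q
    let ?m = "snd (F (Suc q))"
    have "N \<le> ?m" using len[of "Suc q"] by simp
    have "\<forall>i\<le>?m. fst (F (Suc q)) i dvd fst (F (Suc q)) ?m"
      "Suc q dvd fst (F (Suc q)) ?m"
      using F(2)[of q] unfolding S_def by blast+
    moreover have "n i = fst (F (Suc q)) i" if "i \<le> ?m" for i using that by (rule n_eq)
    ultimately have "\<forall>i\<le>?m. n i dvd n ?m" "Suc q dvd n ?m" by auto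
    with \<open>N \<le> ?m\<close> show "\<exists>m\<ge>N. (\<forall>i\<le>m. n i dvd n m) \<and> Suc q dvd n m" by blast
  qed
qed

section \<open>The value of the supremum below 2\<close>

text \<open>The sequence that begins with the first \<open>N + 1\<close> terms of \<open>a lam\<close> and absorbs all denominators
  represents every rational between 0 and the sum of these terms: the denominator of the rational divides
  some \<open>n m\<close> to which \<open>fraction_in_P\<close> applies.\<close>

lemma sum_a_in_lengths:
  assumes "1 < lam" "lam < 2"
  shows "(\<Sum>i\<le>N. 1 / real (a lam i)) \<in> lengths lam"
proof -
  let ?s = "\<Sum>i\<le>N. 1 / real (a lam i)"
  obtain n where n: "slow lam n" "\<And>i. i \<le> N \<Longrightarrow> n i = a lam i"
    "\<And>q. \<exists>m\<ge>N. (\<forall>i\<le>m. n i dvd n m) \<and> Suc q dvd n m"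
    using slow_sequence_absorbing_denominators[OF assms(2) slow_a[OF assms]] by metis
  have pos: "n i > 0" and ratio: "n (Suc i) \<le> 2 * n i" for i
    using n(1) by (auto simp: slow_def)
  have "r \<in> P (\<lambda>i. 1 / real (n i))" if r: "r \<in> \<rat>" "0 < r" "r < ?s" for r
  proof -
    obtain u q :: nat where uq: "q \<noteq> 0" "\<bar>r\<bar> = real u / real q" "coprime u q"
      using Rats_abs_nat_div_natE[OF r(1)] by blast
    obtain q' where q': "q = Suc q'" using uq(1) not0_implies_Suc by blast
    obtain m where m: "m \<ge> N" "\<forall>i\<le>m. n i dvd n m" "q dvd n m"
      using n(3)[of q'] q' by auto
    from m(3) obtain v where v: "n m = q * v" by (elim dvdE)
    have vpos: "v > 0" using pos[of m] v by (cases v) auto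
    have req: "r = real (u * v) / real (n m)"
      using uq(2) r(2) vpos v by simp
    have "?s = (\<Sum>i\<le>N. 1 / real (n i))" using n(2) by simp
    also have "\<dots> \<le> (\<Sum>i\<le>m. 1 / real (n i))"
      using m(1) by (intro sum_mono2) auto
    finally have "r \<le> (\<Sum>i\<le>m. 1 / real (n i))" using r(3) by linarith
    then show ?thesis unfolding req
      using m(2) by (intro fraction_in_P pos ratio) auto
  qed
  then have "\<rat> \<inter> {0<..<?s} \<subseteq> P (\<lambda>i. 1 / real (n i))" by auto
  moreover have "0 \<le> ?s" by (intro sum_nonneg) simp
  ultimately have "?s - 0 \<in> lengths lam"
    unfolding lengths_def using slow_imp_lacunary[OF n(1)] by blast
  then show ?thesis by simp
qed

lemma a_le_lacunary:
  assumes "lam > 1" "lacunary lam n"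
  shows "a lam i \<le> n i"
proof (induction i)
  case 0
  show ?case using assms(2) by (simp add: lacunary_def Suc_leI)
next
  case (Suc i)
  have "lam * real (a lam i) \<le> lam * real (n i)" using Suc assms(1) by simp
  also have "\<dots> \<le> real (n (Suc i))"
    using assms(2) by (rule lacunary_step)
  finally show ?case by (simp only: a.simps nat_le_iff ceiling_le_iff of_int_of_nat_eq)
qed

lemma a_inverse_le:
  assumes "lam > 1"
  shows "1 / real (a lam i) \<le> (1 / lam) ^ i"
  using lacunary_growth[OF assms lacunary_a[OF assms], of i] assms
  by (simp add: power_one_over frac_le)

lemma summable_a:
  assumes "lam > 1"
  shows "summable (\<lambda>i. 1 / real (a lam i))"
proof (rule summable_comparison_test')
  show "summable (\<lambda>i. (1 / lam) ^ i)" using assms by (intro summable_geometric) simp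
  show "norm (1 / real (a lam i)) \<le> (1 / lam) ^ i" if "i \<ge> 0" for i
    using a_inverse_le[OF assms] by simp
qed

text \<open>All rationals in the interval are subset sums, so they lie between 0 and the sum for
  \<open>a lam\<close>; by density so do the end points of the interval, unless it is empty.\<close>

lemma lengths_le_suminf_a:
  assumes "lam > 1" "l \<in> lengths lam"
  shows "l \<le> (\<Sum>i. 1 / real (a lam i))"
proof -
  let ?C = "\<Sum>i. 1 / real (a lam i)"
  obtain \<alpha> \<beta> n where l: "l = \<beta> - \<alpha>" "\<alpha> \<le> \<beta>" "lacunary lam n"
    and sub: "\<rat> \<inter> {\<alpha><..<\<beta>} \<subseteq> P (\<lambda>i. 1 / real (n i))"
    using assms(2) by (auto simp: lengths_def)
  have apos: "a lam i > 0" for i using lacunary_a[OF assms(1)] by (simp add: lacunary_def)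
  have bounds: "0 \<le> r \<and> r \<le> ?C" if "r \<in> \<rat>" "\<alpha> < r" "r < \<beta>" for r
  proof -
    have rP: "r \<in> P (\<lambda>i. 1 / real (n i))" using sub that by auto
    then obtain T where T: "finite T" "r = (\<Sum>i\<in>T. 1 / real (n i))"
      by (auto simp: P_def)
    have "r \<le> (\<Sum>i\<in>T. 1 / real (a lam i))" unfolding T(2)
      using a_le_lacunary[OF assms(1) l(3)] apos by (intro sum_mono frac_le) auto
    also have "\<dots> \<le> ?C"
      using T(1) by (intro sum_le_suminf summable_a assms) auto
    finally show ?thesis using P_bounds(1)[OF assms(1) l(3) rP] by simp
  qed
  have "0 \<le> ?C" by (intro suminf_nonneg summable_a assms) simp
  show ?thesis
  proof (rule ccontr)
    assume "\<not> l \<le> ?C"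
    then have gt: "\<alpha> + ?C < \<beta>" using l by simp
    have "\<alpha> \<ge> 0"
    proof (rule ccontr)
      assume "\<not> \<alpha> \<ge> 0"
      then have "\<alpha> < min 0 \<beta>" using gt \<open>0 \<le> ?C\<close> by simp
      from Rats_dense_in_real[OF this] bounds show False by force
    qed
    then have "max \<alpha> ?C < \<beta>" using gt \<open>0 \<le> ?C\<close> by simp
    from Rats_dense_in_real[OF this] bounds show False by force
  qed
qed

lemma sums_R:
  assumes "1 < lam" "lam < 2"
  shows "(\<lambda>i. 1 / real (a lam i)) sums R lam"
proof -
  let ?C = "\<Sum>i. 1 / real (a lam i)"
  have "R lam \<le> ?C" unfolding R_def
    using lengths_nonempty lengths_le_suminf_a assms by (intro cSup_least) auto
  moreover have "?C \<le> R lam"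
  proof (rule suminf_le_const[OF summable_a[OF assms(1)]])
    fix N
    have "(\<Sum>i<N. 1 / real (a lam i)) \<le> (\<Sum>i\<le>N. 1 / real (a lam i))"
      by (intro sum_mono2) auto
    also have "\<dots> \<le> R lam" unfolding R_def
      using sum_a_in_lengths[OF assms] bdd_above_lengths[OF assms(1)] by (intro cSup_upper) auto
    finally show "(\<Sum>i<N. 1 / real (a lam i)) \<le> R lam" .
  qed
  ultimately show ?thesis using summable_sums[OF summable_a[OF assms(1)]] by simp
qed

section \<open>Behaviour near 1 and near 2\<close>

text \<open>While $(\lambda - 1) i \le 1$, multiplying $i$ by $\lambda$ adds at most 1, so rounding up gives at most
  the next integer.\<close>

lemma a_le_Suc:
  assumes "1 < lam" "(lam - 1) * real N \<le> 1" "i \<le> N"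
  shows "a lam i \<le> Suc i"
  using assms(3)
proof (induction i)
  case 0
  then show ?case by simp
next
  case (Suc i)
  have "lam * real (a lam i) \<le> lam * real (Suc i)" using Suc assms(1) by simp
  also have "\<dots> = real (Suc i) + (lam - 1) * real (Suc i)" by (simp add: algebra_simps)
  also have "(lam - 1) * real (Suc i) \<le> (lam - 1) * real N"
    using Suc.prems assms(1) by (intro mult_left_mono) auto
  also have "\<dots> \<le> 1" by fact
  finally have "lam * real (a lam i) \<le> real (Suc (Suc i))" by simp
  then show ?case by (simp only: a.simps nat_le_iff ceiling_le_iff of_int_of_nat_eq)
qed

lemma R_at_right_1: "filterlim R at_top (at_right 1)"
  unfolding filterlim_at_top
proof
  fix Z :: real
  have "\<exists>N. Z < (\<Sum>i<N. 1 / real (Suc i))"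
  proof (rule ccontr)
    assume "\<not> ?thesis"
    then have bound: "(\<Sum>i<N. inverse (real (Suc i))) \<le> Z" for N
      by (simp only: not_ex not_less inverse_eq_divide)
    have "summable (\<lambda>i. inverse (real (Suc i)))"
    proof (rule bounded_imp_summable)
      show "(\<Sum>i\<le>N. inverse (real (Suc i))) \<le> Z" for N
        using bound[of "Suc N"] by (simp only: lessThan_Suc_atMost)
    qed simp
    then have "summable (\<lambda>i. inverse (real i))"
      using summable_Suc_iff[of "\<lambda>i. inverse (real i)"] by blast
    then show False using not_summable_harmonic[where 'a = real] by contradiction
  qed
  then obtain N where N: "Z < (\<Sum>i<N. 1 / real (Suc i))" ..
  have "eventually (\<lambda>lam. lam \<in> {1<..<1 + 1 / real (Suc N)}) (at_right (1::real))"
    by (intro eventually_at_right_real) simp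
  then show "eventually (\<lambda>lam. Z \<le> R lam) (at_right 1)"
  proof eventually_elim
    case (elim lam)
    then have lam: "1 < lam" and less: "lam - 1 < 1 / real (Suc N)" by simp_all
    have "1 / real (Suc N) \<le> 1" by simp
    with less have lam2: "lam < 2" by linarith
    from less have lamN: "(lam - 1) * real (Suc N) \<le> 1"
      by (simp only: pos_less_divide_eq of_nat_0_less_iff zero_less_Suc less_imp_le)
    have apos: "a lam i > 0" for i using lacunary_a[OF lam] by (simp add: lacunary_def)
    have "Z \<le> (\<Sum>i<N. 1 / real (Suc i))" using N by simp
    also have "\<dots> \<le> (\<Sum>i<N. 1 / real (a lam i))"
    proof (intro sum_mono frac_le)
      fix i assume "i \<in> {..<N}"
      then have "a lam i \<le> Suc i" by (intro a_le_Suc[OF lam lamN]) simp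
      then show "real (a lam i) \<le> real (Suc i)" by linarith
    qed (use apos in auto)
    also have "\<dots> \<le> R lam"
      using sums_R[OF lam lam2] sum_le_suminf[OF summable_a[OF lam], of "{..<N}"]
      by (simp add: sums_iff)
    finally show ?case .
  qed
qed

lemma R_bounds:
  assumes "1 < lam" "lam < 2"
  shows "2 \<le> R lam" "R lam \<le> 1 / (1 - 1 / lam)"
proof -
  have slow: "slow lam (a lam)" by (rule slow_a[OF assms])
  have pow: "a lam i \<le> 2 ^ i" for i
  proof (induction i)
    case (Suc i)
    have "a lam (Suc i) \<le> 2 * a lam i" using slow by (simp add: slow_def del: a.simps)
    with Suc show ?case by (simp del: a.simps)
  qed simp
  have le: "(1 / 2 :: real) ^ i \<le> 1 / real (a lam i)" for i
  proof -
    have "real (a lam i) \<le> 2 ^ i" using of_nat_mono[OF pow[of i], where 'a = real] by simp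
    moreover have "a lam i > 0" using slow by (simp add: slow_def)
    ultimately show ?thesis by (simp add: power_one_over frac_le)
  qed
  have geo2: "(\<lambda>i. (1 / 2 :: real) ^ i) sums 2"
    using geometric_sums[of "1 / 2 :: real"] by simp
  show "2 \<le> R lam" by (rule sums_le[OF le geo2 sums_R[OF assms]])
  have "(\<lambda>i. (1 / lam) ^ i) sums (1 / (1 - 1 / lam))"
    using assms by (intro geometric_sums) simp
  then show "R lam \<le> 1 / (1 - 1 / lam)"
    by (rule sums_le[OF a_inverse_le[OF assms(1)] sums_R[OF assms]])
qed

lemma R_at_left_2: "(R \<longlongrightarrow> 2) (at_left 2)"
proof (rule tendsto_sandwich)
  have ev: "eventually (\<lambda>lam. lam \<in> {1<..<2}) (at_left (2::real))"
    by (intro eventually_at_left_real) simp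
  show "eventually (\<lambda>lam. 2 \<le> R lam) (at_left 2)"
    using ev by eventually_elim (simp add: R_bounds)
  show "eventually (\<lambda>lam. R lam \<le> 1 / (1 - 1 / lam)) (at_left 2)"
    using ev by eventually_elim (simp add: R_bounds)
  show "((\<lambda>lam::real. 1 / (1 - 1 / lam)) \<longlongrightarrow> 2) (at_left 2)"
    by (rule tendsto_eq_intros refl | simp)+
qed simp

section \<open>Ratios at least 2\<close>

definition halving :: "(nat \<Rightarrow> real) \<Rightarrow> bool" where
  "halving x \<longleftrightarrow> (\<forall>i. 0 \<le> x i \<and> 2 * x (Suc i) \<le> x i)"

lemma halvingD:
  assumes "halving x"
  shows "0 \<le> x i" "2 * x (Suc i) \<le> x i"
  using assms by (auto simp: halving_def)

lemma sum_halving_le: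
  assumes x: "halving x" and T: "finite T" "T \<subseteq> {k..}"
  shows "sum x T \<le> 2 * x k"
proof -
  note pos = halvingD(1)[OF x] and half = halvingD(2)[OF x]
  have block: "sum x {k..<k + M} \<le> 2 * x k - 2 * x (k + M)" for M
  proof (induction M)
    case (Suc M)
    then show ?case using half[of "k + M"] by simp
  qed simp
  obtain M where M: "T \<subseteq> {..<M}" using T(1) finite_nat_iff_bounded by blast
  have "T \<subseteq> {k..<k + M}" using M T(2) by fastforce
  then have "sum x T \<le> sum x {k..<k + M}" using pos by (intro sum_mono2) auto
  then show ?thesis using block[of M] pos[of "k + M"] by linarith
qed

lemma sum_split_at:
  fixes x :: "nat \<Rightarrow> real"
  assumes "finite T"
  shows "sum x T = sum x (T \<inter> {..<k}) + (if k \<in> T then x k else 0) + sum x (T \<inter> {Suc k..})"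
proof -
  have "sum x T = sum x (T \<inter> {..<k}) + sum x (T \<inter> {k..})"
    using assms by (subst sum.union_disjoint[symmetric]) (auto intro!: sum.cong)
  also have "sum x (T \<inter> {k..}) = sum x (T \<inter> {k}) + sum x (T \<inter> {Suc k..})"
    using assms by (subst sum.union_disjoint[symmetric]) (auto intro!: sum.cong)
  finally show ?thesis by auto
qed

text \<open>A term is at least the sum of all later ones, so subset sums are ordered like the binary
  expansions of the indicator functions: the first index where two sets differ decides.\<close>

lemma sum_halving_lexicographic:
  assumes x: "halving x"
    and fin: "finite T" "finite T'"
    and agree: "T \<inter> {..<k} = T' \<inter> {..<k}" and k: "k \<notin> T" "k \<in> T'"
  shows "sum x T \<le> sum x T'"
proof -
  have "sum x (T \<inter> {Suc k..}) \<le> x k"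
    using sum_halving_le[OF x, of "T \<inter> {Suc k..}" "Suc k"] fin halvingD(2)[OF x, of k] by simp
  moreover have "0 \<le> sum x (T' \<inter> {Suc k..})" using halvingD(1)[OF x] by (intro sum_nonneg) auto
  ultimately show ?thesis
    using sum_split_at[OF fin(1), of x k] sum_split_at[OF fin(2), of x k] agree k by simp
qed

text \<open>Among all finite sets, those that agree with \<open>T\<close> below \<open>i\<close> and omit \<open>i\<close> have a sum of at most
  \<open>sum x T + 2 * x (Suc i)\<close>, and those that agree and contain \<open>i\<close> have at least \<open>sum x T + x i\<close>.
  All others lie outside by \<open>sum_halving_lexicographic\<close>, compared with \<open>T\<close> or \<open>insert i T\<close>.\<close>

lemma sum_halving_gap:
  assumes x: "halving x" and T: "T \<subseteq> {..<i}" and T': "finite T'"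
  shows "sum x T' \<le> sum x T + 2 * x (Suc i) \<or> sum x T + x i \<le> sum x T'"
proof (cases "T' \<inter> {..<i} = T")
  case True
  have "sum x (T' \<inter> {Suc i..}) \<le> 2 * x (Suc i)"
    using T' by (intro sum_halving_le[OF x]) auto
  moreover have "0 \<le> sum x (T' \<inter> {Suc i..})" using halvingD(1)[OF x] by (intro sum_nonneg) auto
  ultimately show ?thesis using sum_split_at[OF T', of x i] True by auto
next
  case False
  have finT: "finite T" using T finite_subset by blast
  define k where "k = (LEAST k. (k \<in> T') \<noteq> (k \<in> T) \<and> k < i)"
  have "\<exists>k. (k \<in> T') \<noteq> (k \<in> T) \<and> k < i" using False T by blast
  from LeastI_ex[OF this] have k: "(k \<in> T') \<noteq> (k \<in> T)" "k < i" by (auto simp: k_def)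
  have below: "j \<in> T' \<longleftrightarrow> j \<in> T" if "j < k" for j
    using not_less_Least[of j "\<lambda>k. (k \<in> T') \<noteq> (k \<in> T) \<and> k < i"] that k(2)
    by (auto simp: k_def)
  show ?thesis
  proof (cases "k \<in> T")
    case True
    then have "sum x T' \<le> sum x T"
      using k below by (intro sum_halving_lexicographic[OF x T' finT, of k]) auto
    then show ?thesis using halvingD(1)[OF x, of "Suc i"] by linarith
  next
    case kT: False
    have "sum x (insert i T) \<le> sum x T'"
      using k below kT finT T' by (intro sum_halving_lexicographic[OF x, of _ _ k]) auto
    moreover have "sum x (insert i T) = x i + sum x T" using finT T by (subst sum.insert) auto
    ultimately show ?thesis by linarith
  qed
qed

text \<open>Starting from a subset sum inside the interval, the gap of \<open>sum_halving_gap\<close> at a late index \<open>i\<close>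
  with \<open>n (Suc i) > 2 * n i\<close> is nonempty and still lies inside the interval.\<close>

lemma P_misses_rational_of_strict_doubling:
  assumes lac: "lacunary 2 n" and ab: "\<alpha> < \<beta>"
    and strict: "\<And>M. \<exists>i\<ge>M. n (Suc i) > 2 * n i"
  shows "\<not> \<rat> \<inter> {\<alpha><..<\<beta>} \<subseteq> P (\<lambda>i. 1 / real (n i))"
proof
  assume sub: "\<rat> \<inter> {\<alpha><..<\<beta>} \<subseteq> P (\<lambda>i. 1 / real (n i))"
  define x where "x i = 1 / real (n i)" for i
  have npos: "n i > 0" for i using lac by (simp add: lacunary_def)
  have pos: "0 \<le> x i" for i by (simp add: x_def)
  have half: "2 * x (Suc i) \<le> x i" for i
  proof -
    have "2 * real (n i) \<le> real (n (Suc i))"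
      using lac by (rule lacunary_step)
    then show ?thesis using npos[of i] npos[of "Suc i"] by (simp add: x_def field_simps)
  qed
  have x: "halving x" using pos half by (simp add: halving_def)
  have in_P: "\<exists>T. finite T \<and> r = sum x T" if "r \<in> \<rat>" "\<alpha> < r" "r < \<beta>" for r
    using sub that by (auto simp: P_def x_def)
  obtain r where r: "r \<in> \<rat>" "\<alpha> < r" "r < \<beta>" using Rats_dense_in_real[OF ab] by blast
  obtain T where T: "finite T" "r = sum x T" using in_P[OF r] by blast
  obtain M1 where M1: "T \<subseteq> {..<M1}" using T(1) finite_nat_iff_bounded by blast
  obtain M2 where M2: "(1 / 2 :: real) ^ M2 < \<beta> - r"
    using real_arch_pow_inv[of "\<beta> - r" "1 / 2"] r(3) by auto
  obtain i where i: "i \<ge> max M1 M2" "n (Suc i) > 2 * n i" using strict by blast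
  have "x i \<le> (1 / 2) ^ i"
    using lacunary_growth[OF _ lac, of i] by (simp add: x_def power_one_over frac_le)
  also have "\<dots> \<le> (1 / 2) ^ M2" using i(1) by (intro power_decreasing) auto
  finally have xi: "x i < \<beta> - r" using M2 by linarith
  have "2 * x (Suc i) < x i"
  proof -
    have "2 * real (n i) < real (n (Suc i))" using i(2) by linarith
    then show ?thesis using npos[of i] npos[of "Suc i"] by (simp add: x_def field_simps)
  qed
  then have "sum x T + 2 * x (Suc i) < sum x T + x i" by simp
  from Rats_dense_in_real[OF this]
  obtain t where t: "t \<in> \<rat>" "sum x T + 2 * x (Suc i) < t" "t < sum x T + x i" by blast
  have "\<alpha> < t" "t < \<beta>" using t r T(2) xi pos[of "Suc i"] by linarith+
  then obtain T' where T': "finite T'" "t = sum x T'" using in_P t(1) by blast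
  have "T \<subseteq> {..<i}" using M1 i(1) by fastforce
  from sum_halving_gap[OF x this T'(1)] t T'(2) show False by linarith
qed

text \<open>If \<open>p\<close> is large enough, two consecutive multiples of \<open>1 / p\<close> lie in the interval, and at most one
  of their numerators is divisible by \<open>p\<close>.\<close>

lemma rational_with_prime_denominator:
  fixes \<alpha> \<beta> :: real and B :: nat
  assumes "\<alpha> < \<beta>"
  obtains p u where "prime p" "p > B" "\<not> int p dvd u" "\<alpha> < of_int u / real p" "of_int u / real p < \<beta>"
proof -
  obtain B' :: nat where B': "2 / (\<beta> - \<alpha>) < real B'" using reals_Archimedean2 by blast
  obtain p where p: "prime p" "p > max B B'" using bigger_prime by blast
  have ppos: "real p > 0" using p(2) by simp
  have "2 / (\<beta> - \<alpha>) < real p" using B' p(2) by simp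
  then have width: "2 < (\<beta> - \<alpha>) * real p" using assms by (simp add: field_simps)
  define v where "v = \<lfloor>\<alpha> * real p\<rfloor> + 1"
  have v: "\<alpha> * real p < of_int v" "of_int v \<le> \<alpha> * real p + 1" unfolding v_def by linarith+
  obtain u where u: "u = v \<or> u = v + 1" "\<not> int p dvd u"
  proof (cases "int p dvd v")
    case True
    have "\<not> int p dvd v + 1"
    proof
      assume "int p dvd v + 1"
      then have "int p dvd 1" using True by (simp add: dvd_add_right_iff)
      then show False using p(1) by (simp add: not_prime_1 prime_nat_iff)
    qed
    then show ?thesis using that by blast
  qed (use that in blast)
  have "\<alpha> * real p < of_int u" "of_int u < \<beta> * real p"
    using u(1) v width by (auto simp: algebra_simps)
  then have "\<alpha> < of_int u / real p" "of_int u / real p < \<beta>"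
    using ppos by (simp_all add: pos_less_divide_eq pos_divide_less_eq)
  then show ?thesis using that[of p u] p u(2) by auto
qed

text \<open>Every subset sum has a denominator dividing \<open>A * 2 ^ J\<close>, where \<open>A\<close> is fixed by the terms before
  the doubling starts; a prime larger than \<open>A\<close> and 2 cannot divide it.\<close>

lemma P_misses_rational_of_eventual_doubling:
  assumes npos: "\<And>i. n i > 0" and ab: "\<alpha> < \<beta>"
    and double: "\<And>i. i \<ge> M \<Longrightarrow> n (Suc i) = 2 * n i"
  shows "\<not> \<rat> \<inter> {\<alpha><..<\<beta>} \<subseteq> P (\<lambda>i. 1 / real (n i))"
proof
  assume sub: "\<rat> \<inter> {\<alpha><..<\<beta>} \<subseteq> P (\<lambda>i. 1 / real (n i))"
  define A where "A = (\<Prod>i\<le>M. n i)"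
  have Apos: "A > 0" using npos by (simp add: A_def prod_pos)
  obtain p u where pu: "prime p" "p > max A 2" "\<not> int p dvd u"
    "\<alpha> < of_int u / real p" "of_int u / real p < \<beta>"
    using rational_with_prime_denominator[OF ab] by metis
  have "of_int u / real p \<in> \<rat>" by simp
  then have "of_int u / real p \<in> P (\<lambda>i. 1 / real (n i))" using sub pu(4,5) by auto
  then obtain T where T: "finite T" "of_int u / real p = (\<Sum>i\<in>T. 1 / real (n i))"
    by (auto simp: P_def)
  obtain J where J: "T \<subseteq> {..<J}" using T(1) finite_nat_iff_bounded by blast
  have pow: "n (M + j) = 2 ^ j * n M" for j
    by (induction j) (simp_all add: double)
  have dvd: "n i dvd A * 2 ^ J" if "i < J" for i
  proof (cases "i \<le> M")
    case True
    then have "n i dvd A" unfolding A_def by (intro dvd_prodI) auto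
    then show ?thesis by simp
  next
    case False
    then obtain j where j: "i = M + j" using le_Suc_ex nat_le_linear by blast
    have "n M dvd A" unfolding A_def by (intro dvd_prodI) auto
    moreover have "(2::nat) ^ j dvd 2 ^ J" using that j by (intro le_imp_power_dvd) simp
    ultimately show ?thesis unfolding j pow by (metis mult.commute mult_dvd_mono)
  qed
  define s where "s = (\<Sum>i\<in>T. A * 2 ^ J div n i)"
  have "real s = (\<Sum>i\<in>T. real (A * 2 ^ J) * (1 / real (n i)))" unfolding s_def of_nat_sum
  proof (rule sum.cong[OF refl])
    fix i assume "i \<in> T"
    then have "n i dvd A * 2 ^ J" using J by (intro dvd) auto
    then show "real (A * 2 ^ J div n i) = real (A * 2 ^ J) * (1 / real (n i))"
      by (simp only: real_of_nat_div) simp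
  qed
  also have "\<dots> = real (A * 2 ^ J) * (of_int u / real p)"
    unfolding T(2) by (simp only: sum_distrib_left)
  finally have "real s * real p = real (A * 2 ^ J) * of_int u"
    using pu(2) by simp
  then have "real_of_int (int s * int p) = real_of_int (int (A * 2 ^ J) * u)" by simp
  then have "int s * int p = int (A * 2 ^ J) * u" by (simp only: of_int_eq_iff)
  then have "int p dvd int (A * 2 ^ J) * u" by (metis dvd_triv_right)
  moreover have prime_int: "prime (int p)" using pu(1) by simp
  ultimately have "int p dvd int (A * 2 ^ J)" using pu(3) prime_dvd_mult_iff by blast
  then have "p dvd A * 2 ^ J" by (simp only: int_dvd_int_iff)
  then have "p dvd A \<or> p dvd 2" using pu(1) by (meson prime_dvd_mult_iff prime_dvd_power)
  then show False using pu(2) Apos by (auto dest!: dvd_imp_le)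
qed

lemma R_eq_0:
  assumes "lam \<ge> 2"
  shows "R lam = 0"
proof -
  have "l = 0" if l: "l \<in> lengths lam" for l
  proof -
    obtain \<alpha> \<beta> n where ab: "l = \<beta> - \<alpha>" "\<alpha> \<le> \<beta>" and n: "lacunary lam n"
      and sub: "\<rat> \<inter> {\<alpha><..<\<beta>} \<subseteq> P (\<lambda>i. 1 / real (n i))"
      using l by (auto simp: lengths_def)
    have lac: "lacunary 2 n" using n assms by (auto simp: lacunary_def intro: order_trans)
    have npos: "n i > 0" for i using n by (simp add: lacunary_def)
    have "2 * real (n i) \<le> real (n (Suc i))" for i
      using lac by (rule lacunary_step)
    then have ge: "2 * n i \<le> n (Suc i)" for i
      by (metis of_nat_le_iff of_nat_mult of_nat_numeral)
    have "\<not> \<alpha> < \<beta>"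
    proof
      assume lt: "\<alpha> < \<beta>"
      show False
      proof (cases "\<forall>M. \<exists>i\<ge>M. n (Suc i) > 2 * n i")
        case True
        then show False using P_misses_rational_of_strict_doubling[OF lac lt] sub by blast
      next
        case False
        then obtain M where "\<And>i. i \<ge> M \<Longrightarrow> n (Suc i) = 2 * n i"
          using ge by (meson le_antisym not_less)
        from P_misses_rational_of_eventual_doubling[of n, OF npos lt this] sub show False by blast
      qed
    qed
    then show ?thesis using ab by simp
  qed
  then have "lengths lam = {0}" using lengths_nonempty[of lam] assms by fastforce
  then show ?thesis by (simp add: R_def)
qed

theorem theorem2:
  shows "(\<forall>lam::real. 1 < lam \<and> lam < 2 \<longrightarrow> (\<lambda>i. 1 / real (a lam i)) sums R lam)
    \<and> filterlim R at_top (at_right 1)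
    \<and> (R \<longlongrightarrow> 2) (at_left 2)
    \<and> (\<forall>lam::real. lam \<ge> 2 \<longrightarrow> R lam = 0)"
  using sums_R R_at_right_1 R_at_left_2 R_eq_0 by blast

end
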